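(* Let $G$ be a bipartite outerplanar graph and let $k\ge 3$ be an integer. Let $S=(1,3,\ldots,3)$ be the sequence consisting of one integer $1$ followed by $k$ copies of the integer $3$. If $\Delta(G)\le k$, then $G$ is $S$-packing colorable.
   Context: All graphs are finite and simple; $\Delta(G)$ denotes the maximum degree of $G$. A graph is outerplanar if it has a planar drawing in which all vertices lie on the outer face. For a positive integer $d$, a set $A\subseteq V(G)$ is a $d$-packing if any two distinct vertices of $A$ are at distance greater than $d$ in $G$. For a nondecreasing sequence $S=(s_1,\ldots,s_m)$ of positive integers, an $S$-packing coloring of $G$ is a map $c:V(G)\to\{1,\ldots,m\}$ such that for every $i$, the set $c^{-1}(i)$ is an $s_i$-packing; $G$ is $S$-packing colorable if such a map exists. *)

theory Defs
  imports
    "HOL-Analysis.Analysis"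
    "Graph_Theory.Pair_Digraph"
    "Graph_Theory.Shortest_Path"
begin

text \<open>
  A finite simple graph is a \<^term>\<open>pair_graph\<close>: a finite, symmetric, loop-free digraph without
  parallel arcs. An undirected edge \<open>uv\<close> is the pair of arcs \<open>(u, v)\<close> and \<open>(v, u)\<close>, so the
  degree of a vertex is its out-degree.
\<close>

text \<open>The inserted 0 only matters for the null graph, which \<^term>\<open>pair_graph\<close> allows.\<close>

definition max_degree :: "'a pair_pre_digraph \<Rightarrow> nat" where
  "max_degree G = Max (insert 0 (out_degree (with_proj G) ` pverts G))"

definition bipartite :: "'a pair_pre_digraph \<Rightarrow> bool" where
  "bipartite G \<longleftrightarrow>
     (\<exists>A B. A \<union> B = pverts G \<and> A \<inter> B = {} \<and>
       (\<forall>(u, v) \<in> parcs G. (u \<in> A \<and> v \<in> B) \<or> (u \<in> B \<and> v \<in> A)))"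

text \<open>
  In a drawing in the plane, vertex \<open>v\<close> is placed at \<open>pos v\<close>, and the edge \<open>uv\<close> is drawn as a simple
  arc \<open>\<gamma> (u, v)\<close> from \<open>pos u\<close> to \<open>pos v\<close>. The two orientations of an edge are drawn as the same curve.
\<close>

definition planar_drawing ::
    "'a pair_pre_digraph \<Rightarrow> ('a \<Rightarrow> complex) \<Rightarrow> ('a \<times> 'a \<Rightarrow> real \<Rightarrow> complex) \<Rightarrow> bool" where
  "planar_drawing G pos \<gamma> \<longleftrightarrow>
     inj_on pos (pverts G) \<and>
     (\<forall>(u, v) \<in> parcs G.
        arc (\<gamma> (u, v)) \<and> pathstart (\<gamma> (u, v)) = pos u \<and> pathfinish (\<gamma> (u, v)) = pos v \<and>
        \<gamma> (v, u) = reversepath (\<gamma> (u, v)) \<and>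
        path_image (\<gamma> (u, v)) \<inter> pos ` pverts G = {pos u, pos v}) \<and>
     (\<forall>(u, v) \<in> parcs G. \<forall>(x, y) \<in> parcs G. {u, v} \<noteq> {x, y} \<longrightarrow>
        path_image (\<gamma> (u, v)) \<inter> path_image (\<gamma> (x, y)) \<subseteq> pos ` ({u, v} \<inter> {x, y}))"

definition drawn_points ::
    "'a pair_pre_digraph \<Rightarrow> ('a \<Rightarrow> complex) \<Rightarrow> ('a \<times> 'a \<Rightarrow> real \<Rightarrow> complex) \<Rightarrow> complex set" where
  "drawn_points G pos \<gamma> = pos ` pverts G \<union> (\<Union>e \<in> parcs G. path_image (\<gamma> e))"

text \<open>
  The outer face is the unbounded component of the complement of the drawing, which is
  \<^const>\<open>outside\<close> of the (compact) drawing. A vertex lies on a face if it lies on its boundary.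
\<close>

definition outerplanar :: "'a pair_pre_digraph \<Rightarrow> bool" where
  "outerplanar G \<longleftrightarrow>
     (\<exists>pos \<gamma>. planar_drawing G pos \<gamma> \<and>
        pos ` pverts G \<subseteq> frontier (outside (drawn_points G pos \<gamma>)))"

text \<open>
  The distance is the library's shortest-path distance with unit arc weights; it is \<open>\<infinity>\<close> between
  vertices in different components.
\<close>

definition graph_dist :: "'a pair_pre_digraph \<Rightarrow> 'a \<Rightarrow> 'a \<Rightarrow> ereal" where
  "graph_dist G u v = wf_digraph.\<mu> (with_proj G) (\<lambda>_. 1) u v"

definition packing :: "'a pair_pre_digraph \<Rightarrow> nat \<Rightarrow> 'a set \<Rightarrow> bool" where
  "packing G d A \<longleftrightarrow> A \<subseteq> pverts G \<and> (\<forall>u \<in> A. \<forall>v \<in> A. u \<noteq> v \<longrightarrow> ereal (real d) < graph_dist G u v)"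

text \<open>
  Colours are \<open>1, \<dots>, m\<close> whereas list positions start at 0, hence \<open>S ! (i - 1)\<close> for \<open>s\<^sub>i\<close>. The
  sequence \<open>S\<close> is meant to be a nondecreasing list of positive integers.
\<close>

definition S_packing_coloring :: "'a pair_pre_digraph \<Rightarrow> nat list \<Rightarrow> ('a \<Rightarrow> nat) \<Rightarrow> bool" where
  "S_packing_coloring G S c \<longleftrightarrow>
     c \<in> pverts G \<rightarrow> {1..length S} \<and>
     (\<forall>i \<in> {1..length S}. packing G (S ! (i - 1)) {v \<in> pverts G. c v = i})"

definition S_packing_colorable :: "'a pair_pre_digraph \<Rightarrow> nat list \<Rightarrow> bool" where
  "S_packing_colorable G S \<longleftrightarrow> (\<exists>c. S_packing_coloring G S c)"

end

theory Submission
  imports Defs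
begin

text \<open>
  Let \<open>A\<close> and \<open>B\<close> be the two sides of \<open>G\<close>. Colour \<open>A\<close> with the colour of radius 1. Distances
  within \<open>B\<close> are even, so it remains to colour \<open>B\<close> with \<open>k\<close> colours such that the neighbours of
  each vertex of \<open>A\<close> receive distinct colours.

  The only consequence of outerplanarity that is needed is that no two vertices are joined by three
  internally disjoint paths that all have inner vertices: one of three arcs with common ends lies
  inside the closed curve formed by the other two, so its inner vertices are not on the outer face.

  The colouring is built up on a growing vertex set \<open>W\<close>, starting from the empty set, such that each
  component of \<open>G - W\<close> has at most one neighbour in \<open>W\<close> or exactly two, which are adjacent. If some
  component is attached to both ends of an edge \<open>xy\<close> with \<open>x \<in> A\<close>, add to \<open>W\<close> a shortest path from
  \<open>x\<close> to \<open>y\<close> through \<open>G - W\<close>. With \<open>xy\<close> it forms a cycle, and the absence of thetas forces every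
  remaining component to be attached to that cycle at a vertex or an edge. The path has no chords, so
  its first vertex in \<open>B\<close> must only avoid the at most \<open>k - 1\<close> colours of the other neighbours of
  \<open>x\<close>, and \<open>k \<ge> 3\<close> colours suffice to continue to \<open>y\<close> with consecutive vertices of \<open>B\<close> coloured
  differently. Otherwise add a single vertex, adjacent to \<open>W\<close> if possible; it has at most one
  neighbour in \<open>W\<close>.
\<close>

abbreviation upath :: "('a \<times> 'a) set \<Rightarrow> 'a list \<Rightarrow> bool" where
  "upath E \<equiv> successively (\<lambda>u v. (u, v) \<in> E)"

text \<open>An empty list of inner vertices stands for the edge from \<open>p\<close> to
  \<open>q\<close>. A cycle with a chord is outerplanar, so three paths are excluded only if all of
  them have inner vertices.\<close>

definition theta_free :: "('a \<times> 'a) set \<Rightarrow> bool" where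
  "theta_free E \<longleftrightarrow>
     (\<forall>p q xs ys zs.
        upath E (p # xs @ [q]) \<and> upath E (p # ys @ [q]) \<and> upath E (p # zs @ [q]) \<and>
        distinct (p # xs @ [q]) \<and> distinct (p # ys @ [q]) \<and> distinct (p # zs @ [q]) \<and>
        set xs \<inter> set ys = {} \<and> set ys \<inter> set zs = {} \<and> set xs \<inter> set zs = {} \<longrightarrow>
        xs = [] \<or> ys = [] \<or> zs = [])"

section \<open>Outerplanar graphs are theta-free\<close>

lemma connected_subset_inside:
  assumes "connected T" "T \<inter> S = {}" "inside S \<inter> T \<noteq> {}"
  shows "T \<subseteq> inside S"
  using inside_outside_intersect_connected[of T S] assms inside_Un_outside[of S] by blast

lemma Jordan_two_arcs:
  fixes c1 c2 :: "real \<Rightarrow> complex"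
  assumes "arc c1" "arc c2" "pathstart c1 = a" "pathfinish c1 = b" "pathstart c2 = a" "pathfinish c2 = b"
    and "path_image c1 \<inter> path_image c2 \<subseteq> {a, b}"
  defines "J \<equiv> path_image c1 \<union> path_image c2"
  shows "inside J \<noteq> {}" "open (inside J)" "connected (inside J)" "connected (outside J)"
    "frontier (inside J) = J" "compact J"
proof -
  let ?c = "c1 +++ reversepath c2"
  have "simple_path ?c"
    using assms by (intro simple_path_join_loop) (auto simp: arc_reversepath)
  moreover have "path_image ?c = J"
    using assms by (simp add: path_image_join)
  moreover have "pathfinish ?c = pathstart ?c"
    using assms by simp
  ultimately show "inside J \<noteq> {}" "open (inside J)" "connected (inside J)" "connected (outside J)"
    "frontier (inside J) = J" "compact J"
    using Jordan_inside_outside[of ?c] compact_simple_path_image[of ?c] by auto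
qed

text \<open>If no arc lay inside the other two, Janiszewski's theorem would join a point inside
  \<open>c2 \<union> c3\<close> to infinity off all three arcs, the intersection of \<open>c1 \<union> c2\<close> and \<open>c1 \<union> c3\<close> being
  the connected set \<open>c1\<close>.\<close>

lemma theta_curve:
  fixes c1 c2 c3 :: "real \<Rightarrow> complex"
  assumes "arc c1" "arc c2" "arc c3"
    and "pathstart c1 = a" "pathstart c2 = a" "pathstart c3 = a"
    and "pathfinish c1 = b" "pathfinish c2 = b" "pathfinish c3 = b"
    and "path_image c1 \<inter> path_image c2 \<subseteq> {a, b}"
    and "path_image c1 \<inter> path_image c3 \<subseteq> {a, b}"
    and "path_image c2 \<inter> path_image c3 \<subseteq> {a, b}"
  shows "path_image c1 - {a, b} \<subseteq> inside (path_image c2 \<union> path_image c3) \<or>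
         path_image c2 - {a, b} \<subseteq> inside (path_image c1 \<union> path_image c3) \<or>
         path_image c3 - {a, b} \<subseteq> inside (path_image c1 \<union> path_image c2)"
proof -
  define C1 C2 C3 where C: "C1 = path_image c1" "C2 = path_image c2" "C3 = path_image c3"
  have J12: "open (inside (C1 \<union> C2))" "connected (outside (C1 \<union> C2))" "frontier (inside (C1 \<union> C2)) = C1 \<union> C2"
      "compact (C1 \<union> C2)"
    using Jordan_two_arcs[of c1 c2 a b] assms by (simp_all add: C)
  have J13: "open (inside (C1 \<union> C3))" "connected (outside (C1 \<union> C3))" "frontier (inside (C1 \<union> C3)) = C1 \<union> C3"
      "compact (C1 \<union> C3)"
    using Jordan_two_arcs[of c1 c3 a b] assms by (simp_all add: C)
  have J23: "inside (C2 \<union> C3) \<noteq> {}" "connected (inside (C2 \<union> C3))" "frontier (inside (C2 \<union> C3)) = C2 \<union> C3"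
    using Jordan_two_arcs[of c2 c3 a b] assms by (simp_all add: C)
  have int: "C1 \<inter> C2 \<subseteq> {a, b}" "C1 \<inter> C3 \<subseteq> {a, b}" "C2 \<inter> C3 \<subseteq> {a, b}"
    using assms by (auto simp: C)
  have ab: "a \<in> C1" "b \<in> C1" "a \<in> C2" "b \<in> C2" "a \<in> C3" "b \<in> C3"
    using assms pathstart_in_path_image pathfinish_in_path_image unfolding C by metis+
  obtain x where x: "x \<in> inside (C2 \<union> C3)" using J23 by blast
  have bdd: "bounded (C1 \<union> (C2 \<union> C3))"
    using assms unfolding C by (simp add: arc_imp_path bounded_path_image)
  then obtain y where y: "y \<in> outside (C1 \<union> (C2 \<union> C3))"
    using outside_bounded_nonempty by blast
  \<comment> \<open>If \<open>C1\<close> misses the region inside \<open>C2 \<union> C3\<close>,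
    this connected region avoids \<open>C1 \<union> D'\<close>, so it lies inside that curve as soon
    as it meets its interior. Taking closures brings in the boundary arc \<open>D\<close>.\<close>
  have sub: "D - {a, b} \<subseteq> inside (C1 \<union> D')"
    if meet: "inside (C2 \<union> C3) \<inter> inside (C1 \<union> D') \<noteq> {}"
      and no: "C1 \<inter> inside (C2 \<union> C3) = {}" and D: "(D, D') = (C3, C2) \<or> (D, D') = (C2, C3)"
    for D D'
  proof -
    have "inside (C2 \<union> C3) \<subseteq> inside (C1 \<union> D')"
    proof (rule connected_subset_inside)
      show "inside (C2 \<union> C3) \<inter> (C1 \<union> D') = {}"
        using no D inside_no_overlap[of "C2 \<union> C3"] by blast
    qed (use J23 meet in auto)
    then have "closure (inside (C2 \<union> C3)) \<subseteq> closure (inside (C1 \<union> D'))"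
      by (rule closure_mono)
    moreover have "D \<subseteq> closure (inside (C2 \<union> C3))"
      using D J23(3) by (auto simp: frontier_def)
    moreover have "closure (inside (C1 \<union> D')) = inside (C1 \<union> D') \<union> (C1 \<union> D')"
      using J12 J13 D closure_Un_frontier by (metis prod.inject)
    ultimately show ?thesis using int D by auto
  qed
  have "C1 - {a, b} \<subseteq> inside (C2 \<union> C3)" if "C1 \<inter> inside (C2 \<union> C3) \<noteq> {}"
  proof (rule connected_subset_inside)
    show "connected (C1 - {a, b})"
      using connected_simple_path_endless[of c1] assms by (simp add: C arc_imp_simple_path)
    show "inside (C2 \<union> C3) \<inter> (C1 - {a, b}) \<noteq> {}"
      using that ab inside_no_overlap[of "C2 \<union> C3"] by blast
  qed (use int in auto)
  moreover have "C1 \<inter> inside (C2 \<union> C3) \<noteq> {} \<or> inside (C2 \<union> C3) \<inter> inside (C1 \<union> C2) \<noteq> {} \<or>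
     inside (C2 \<union> C3) \<inter> inside (C1 \<union> C3) \<noteq> {}"
  proof (rule ccontr)
    assume "\<not> ?thesis"
    then have none: "x \<notin> C1" "x \<notin> inside (C1 \<union> C2)" "x \<notin> inside (C1 \<union> C3)" using x by auto
    moreover have "x \<notin> C2" "x \<notin> C3" using x inside_no_overlap[of "C2 \<union> C3"] by blast+
    ultimately have xo: "x \<in> outside (C1 \<union> C2)" "x \<in> outside (C1 \<union> C3)"
      using inside_Un_outside[of "C1 \<union> C2"] inside_Un_outside[of "C1 \<union> C3"] by blast+
    have yo: "y \<in> outside (C1 \<union> C2)" "y \<in> outside (C1 \<union> C3)" "y \<in> outside (C2 \<union> C3)"
      using y outside_mono[of _ "C1 \<union> (C2 \<union> C3)"] by blast+
    have "C1 = (C1 \<union> C2) \<inter> (C1 \<union> C3)" using int ab by auto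
    moreover have "connected C1" using assms by (simp add: C connected_arc_image)
    moreover have "connected_component (- (C1 \<union> C2)) x y" "connected_component (- (C1 \<union> C3)) x y"
      using J12(2) J13(2) xo yo outside_no_overlap unfolding connected_component_def by fast+
    ultimately have "connected_component (- ((C1 \<union> C2) \<union> (C1 \<union> C3))) x y"
      using J12(4) J13(4) by (intro Janiszewski[of "C1 \<union> C2" "C1 \<union> C3"]) (simp_all only: compact_imp_closed)
    then have "connected_component (- (C2 \<union> C3)) x y"
      by (rule connected_component_of_subset) auto
    then have "y \<in> inside (C2 \<union> C3)" using inside_same_component x by blast
    then show False using yo inside_Int_outside by blast
  qed
  ultimately show ?thesis
    using sub[of C2 C3] sub[of C3 C2] unfolding C by blast
qed

section \<open>Arcs of a planar drawing\<close>

definition path_drawing :: "('a \<times> 'a \<Rightarrow> real \<Rightarrow> complex) \<Rightarrow> 'a list \<Rightarrow> complex set" where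
  "path_drawing \<gamma> xs = (\<Union>e \<in> set (zip xs (tl xs)). path_image (\<gamma> e))"

lemma upath_zip: "upath E xs \<Longrightarrow> set (zip xs (tl xs)) \<subseteq> E"
  by (induction xs rule: induct_list012) auto

locale drawing =
  fixes G :: "'a pair_pre_digraph" and pos :: "'a \<Rightarrow> complex" and \<gamma>
  assumes G: "pair_graph G" and drawing: "planar_drawing G pos \<gamma>"
begin

lemma edge:
  assumes "(u, v) \<in> parcs G"
  shows "arc (\<gamma> (u, v))" "pathstart (\<gamma> (u, v)) = pos u" "pathfinish (\<gamma> (u, v)) = pos v"
  using drawing assms unfolding planar_drawing_def by blast+

lemma edge_Int:
  assumes "(u, v) \<in> parcs G" "(x, y) \<in> parcs G" "{u, v} \<noteq> {x, y}"
  shows "path_image (\<gamma> (u, v)) \<inter> path_image (\<gamma> (x, y)) \<subseteq> pos ` ({u, v} \<inter> {x, y})"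
proof -
  have "\<forall>(u, v) \<in> parcs G. \<forall>(x, y) \<in> parcs G. {u, v} \<noteq> {x, y} \<longrightarrow>
        path_image (\<gamma> (u, v)) \<inter> path_image (\<gamma> (x, y)) \<subseteq> pos ` ({u, v} \<inter> {x, y})"
    using drawing unfolding planar_drawing_def by blast
  then show ?thesis using assms by blast
qed

text \<open>Edges are joined from the front. As the vertices are distinct, the first vertex is an
  end of no later edge, so the first curve meets the remaining arc only at the second
  vertex.\<close>

lemma path_arc:
  assumes "upath (parcs G) xs" "distinct xs" "length xs \<ge> 2"
  shows "\<exists>g. arc g \<and> pathstart g = pos (hd xs) \<and> pathfinish g = pos (last xs) \<and>
    path_image g = path_drawing \<gamma> xs"
  using assms
proof (induction xs rule: induct_list012)
  case (3 u v xs)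
  show ?case
  proof (cases xs)
    case Nil
    then show ?thesis using 3 edge[of u v] by (auto simp: path_drawing_def)
  next
    case (Cons w ws)
    then obtain g where g: "arc g" "pathstart g = pos v" "pathfinish g = pos (last (v # xs))"
      "path_image g = path_drawing \<gamma> (v # xs)"
      using "3.IH"(2) "3.prems" by auto
    have uv: "(u, v) \<in> parcs G" using 3 by simp
    have "path_image (\<gamma> (u, v)) \<inter> path_image (\<gamma> e) \<subseteq> {pos v}"
      if e: "e \<in> set (zip (v # xs) xs)" for e
    proof -
      obtain x y where [simp]: "e = (x, y)" by (cases e)
      have "x \<in> set (v # xs)" "y \<in> set (v # xs)"
        using e set_zip_leftD set_zip_rightD by fastforce+
      then have "u \<noteq> x" "u \<noteq> y" using "3.prems" by auto
      moreover have "(x, y) \<in> parcs G" using e upath_zip[of "parcs G" "v # xs"] "3.prems" by auto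
      ultimately show ?thesis using edge_Int[of u v x y] uv by auto
    qed
    then have "path_image (\<gamma> (u, v)) \<inter> path_image g \<subseteq> {pathstart g}"
      unfolding g path_drawing_def by auto
    then have "arc (\<gamma> (u, v) +++ g)"
      using g edge[OF uv] by (intro arc_join) auto
    moreover have "path_image (\<gamma> (u, v) +++ g) = path_drawing \<gamma> (u # v # xs)"
      using g edge[OF uv] by (simp add: path_image_join path_drawing_def)
    moreover have "pathfinish (\<gamma> (u, v) +++ g) = pos (last (u # v # xs))"
      "pathstart (\<gamma> (u, v) +++ g) = pos (hd (u # v # xs))"
      using g edge[OF uv] by auto
    ultimately show ?thesis by blast
  qed
qed auto

text \<open>Since \<open>xs\<close> is nonempty, each edge of the first path has an end in
  \<open>xs\<close> and hence differs from all edges of the second path, even if that is the single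
  edge from \<open>p\<close> to \<open>q\<close>. Different edges meet only in common ends, which
  here can only be \<open>p\<close> and \<open>q\<close>.\<close>

lemma path_drawing_Int:
  assumes "upath (parcs G) (p # xs @ [q])" "upath (parcs G) (p # ys @ [q])"
    and "distinct (p # xs @ [q])" "distinct (p # ys @ [q])" "set xs \<inter> set ys = {}" "xs \<noteq> []"
  shows "path_drawing \<gamma> (p # xs @ [q]) \<inter> path_drawing \<gamma> (p # ys @ [q]) \<subseteq> {pos p, pos q}"
proof -
  have "path_image (\<gamma> e) \<inter> path_image (\<gamma> e') \<subseteq> {pos p, pos q}"
    if e: "e \<in> set (zip (p # xs @ [q]) (xs @ [q]))" and e': "e' \<in> set (zip (p # ys @ [q]) (ys @ [q]))"
    for e e'
  proof -
    obtain u v where [simp]: "e = (u, v)" by (cases e)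
    obtain x y where [simp]: "e' = (x, y)" by (cases e')
    have uv: "(u, v) \<in> parcs G" and xy: "(x, y) \<in> parcs G"
      using e e' upath_zip[OF assms(1)] upath_zip[OF assms(2)] by auto
    have *: "x \<in> set (p # ys @ [q])" "y \<in> set (p # ys @ [q])"
       "u \<in> set (p # xs @ [q])" "v \<in> set (p # xs @ [q])"
      using e e' set_zip_leftD set_zip_rightD by fastforce+
    have "u \<in> set xs \<or> v \<in> set xs"
    proof (cases "u = p")
      case True
      then have "v = hd (xs @ [q])"
        using e assms(3,6) by (cases xs) (auto dest: set_zip_leftD)
      then show ?thesis using assms(6) by (cases xs) auto
    next
      case False
      have "u \<in> set (butlast (p # xs @ [q]))"
        using e in_set_zip[of "(u,v)"] by (auto simp: nth_Cons' nth_append split: if_splits)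
      then show ?thesis using False by (auto simp: butlast_append)
    qed
    then have "{u, v} \<inter> set xs \<noteq> {}" by blast
    moreover have sub: "{u, v} \<subseteq> set (p # xs @ [q])" "{x, y} \<subseteq> set (p # ys @ [q])" using * by blast+
    moreover have "set xs \<inter> set (p # ys @ [q]) = {}" using assms(3,5) by auto
    ultimately have "{u, v} \<noteq> {x, y}" by blast
    moreover have "set (p # xs @ [q]) \<inter> set (p # ys @ [q]) \<subseteq> {p, q}"
      using assms(5) by auto
    then have "{u, v} \<inter> {x, y} \<subseteq> {p, q}" using Int_mono[OF sub] by (rule order_trans[rotated])
    ultimately show ?thesis using edge_Int[OF uv xy] by auto
  qed
  then show ?thesis unfolding path_drawing_def by fastforce
qed

lemma inner_vertex:
  assumes "upath (parcs G) (p # xs @ [q])" "distinct (p # xs @ [q])" "z \<in> set xs"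
  shows "pos z \<in> path_drawing \<gamma> (p # xs @ [q]) - {pos p, pos q}" "z \<in> pverts G"
proof -
  interpret pair_graph G by (rule G)
  obtain ys zs where xs: "xs = ys @ z # zs" using assms(3) by (meson split_list)
  \<comment> \<open>The successor of \<open>z\<close> on the path: the curve of the edge from
    \<open>z\<close> to \<open>w\<close> starts at \<open>pos z\<close>.\<close>
  define w where "w = hd (zs @ [q])"
  have zw: "(z, w) \<in> set (zip (p # xs @ [q]) (xs @ [q]))"
  proof -
    have "zip ((p # ys) @ z # (zs @ [q])) ((ys @ [z]) @ (zs @ [q])) =
       zip (p # ys) (ys @ [z]) @ zip (z # zs @ [q]) (zs @ [q])"
      by (subst zip_append) auto
    moreover have "(z, w) \<in> set (zip (z # zs @ [q]) (zs @ [q]))"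
      unfolding w_def by (cases zs) auto
    ultimately show ?thesis unfolding xs by simp
  qed
  have E: "(z, w) \<in> parcs G" using zw upath_zip[OF assms(1)] by auto
  then show z: "z \<in> pverts G" by (rule in_arcsD1)
  have "p \<in> pverts G" using assms(1) xs by (cases ys) (auto dest: in_arcsD1)
  moreover have "q \<in> pverts G"
    using assms(1) in_arcsD2[of _ q] by (auto simp: successively_append_iff successively_Cons split: if_splits)
  moreover have "inj_on pos (pverts G)" using drawing by (simp add: planar_drawing_def)
  moreover have "z \<noteq> p" "z \<noteq> q" using assms by auto
  ultimately have "pos z \<noteq> pos p" "pos z \<noteq> pos q" using z by (auto dest: inj_onD)
  moreover have "pos z \<in> path_image (\<gamma> (z, w))"
    using edge[OF E] pathstart_in_path_image by metis
  ultimately show "pos z \<in> path_drawing \<gamma> (p # xs @ [q]) - {pos p, pos q}"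
    using zw unfolding path_drawing_def by auto
qed

lemma path_drawing_subset:
  "upath (parcs G) xs \<Longrightarrow> path_drawing \<gamma> xs \<subseteq> drawn_points G pos \<gamma>"
  using upath_zip unfolding path_drawing_def drawn_points_def by fast

text \<open>\<open>inside S\<close> is open and disjoint from the outer face of the whole drawing,
  hence from the closure of that face, which contains \<open>pos z\<close>.\<close>

lemma not_inside:
  assumes "z \<in> pverts G" "pos ` pverts G \<subseteq> frontier (outside (drawn_points G pos \<gamma>))"
    and "S \<subseteq> drawn_points G pos \<gamma>" "compact S"
  shows "pos z \<notin> inside S"
proof
  assume *: "pos z \<in> inside S"
  have "inside S \<inter> closure (outside (drawn_points G pos \<gamma>)) = {}"
  proof (subst open_Int_closure_eq_empty)
    show "open (inside S)" using assms by (simp add: open_inside compact_imp_closed)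
    show "inside S \<inter> outside (drawn_points G pos \<gamma>) = {}"
      using outside_mono[OF assms(3)] inside_Int_outside[of S] by blast
  qed
  moreover have "pos z \<in> closure (outside (drawn_points G pos \<gamma>))"
    using assms(1,2) by (auto simp: frontier_def)
  ultimately show False using * by blast
qed

end

lemma outerplanar_theta_free:
  assumes "pair_graph G" "outerplanar G"
  shows "theta_free (parcs G)"
  unfolding theta_free_def
proof (intro allI impI, elim conjE, rule ccontr)
  fix p q xs ys zs
  obtain pos \<gamma> where draw: "planar_drawing G pos \<gamma>"
    and outer: "pos ` pverts G \<subseteq> frontier (outside (drawn_points G pos \<gamma>))"
    using assms(2) by (auto simp: outerplanar_def)
  interpret drawing G pos \<gamma> using assms(1) draw by (rule drawing.intro)
  let ?d = "\<lambda>xs. path_drawing \<gamma> (p # xs @ [q])"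
  assume up: "upath (parcs G) (p # xs @ [q])" "upath (parcs G) (p # ys @ [q])" "upath (parcs G) (p # zs @ [q])"
    and dist: "distinct (p # xs @ [q])" "distinct (p # ys @ [q])" "distinct (p # zs @ [q])"
    and disj: "set xs \<inter> set ys = {}" "set ys \<inter> set zs = {}" "set xs \<inter> set zs = {}"
    and "\<not> (xs = [] \<or> ys = [] \<or> zs = [])"
  then have ne: "xs \<noteq> []" "ys \<noteq> []" "zs \<noteq> []" by auto
  obtain c1 where c1: "arc c1" "pathstart c1 = pos p" "pathfinish c1 = pos q" "path_image c1 = ?d xs"
    using path_arc[OF up(1) dist(1)] by auto
  obtain c2 where c2: "arc c2" "pathstart c2 = pos p" "pathfinish c2 = pos q" "path_image c2 = ?d ys"
    using path_arc[OF up(2) dist(2)] by auto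
  obtain c3 where c3: "arc c3" "pathstart c3 = pos p" "pathfinish c3 = pos q" "path_image c3 = ?d zs"
    using path_arc[OF up(3) dist(3)] by auto
  \<comment> \<open>One inner vertex of the path suffices: it lies on the outer face, so it cannot
    be inside two arcs of the drawing.\<close>
  have no: "\<not> ?d us - {pos p, pos q} \<subseteq> inside (path_image c \<union> path_image c')"
    if "upath (parcs G) (p # us @ [q])" "distinct (p # us @ [q])" "us \<noteq> []"
      "path_image c \<union> path_image c' \<subseteq> drawn_points G pos \<gamma>" "arc c" "arc c'" for us c c'
  proof -
    have "compact (path_image c \<union> path_image c')"
      using that by (simp add: compact_Un compact_arc_image)
    then show ?thesis
      using inner_vertex[OF that(1,2), of "hd us"] not_inside[OF _ outer that(4), of "hd us"] that(3)
      by auto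
  qed
  have "?d xs \<subseteq> drawn_points G pos \<gamma>" "?d ys \<subseteq> drawn_points G pos \<gamma>" "?d zs \<subseteq> drawn_points G pos \<gamma>"
    using up by (simp_all add: path_drawing_subset)
  then have "\<not> ?d xs - {pos p, pos q} \<subseteq> inside (?d ys \<union> ?d zs)"
    "\<not> ?d ys - {pos p, pos q} \<subseteq> inside (?d xs \<union> ?d zs)"
    "\<not> ?d zs - {pos p, pos q} \<subseteq> inside (?d xs \<union> ?d ys)"
    using no[OF up(1) dist(1) ne(1), of c2 c3] no[OF up(2) dist(2) ne(2), of c1 c3]
      no[OF up(3) dist(3) ne(3), of c1 c2] c1 c2 c3 by simp_all
  moreover have "?d xs \<inter> ?d ys \<subseteq> {pos p, pos q}" "?d xs \<inter> ?d zs \<subseteq> {pos p, pos q}"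
    "?d ys \<inter> ?d zs \<subseteq> {pos p, pos q}"
    using path_drawing_Int up dist disj ne by simp_all
  ultimately show False
    using theta_curve[of c1 c2 c3 "pos p" "pos q"] c1 c2 c3 by simp
qed

section \<open>Colouring one side of a theta-free bipartite graph\<close>

definition consecutive :: "'a list \<Rightarrow> 'a \<Rightarrow> 'a \<Rightarrow> bool" where
  "consecutive xs u v \<longleftrightarrow> (\<exists>l r. xs = l @ u # v # r)"

lemma consecutive_in_set: "consecutive xs u v \<Longrightarrow> u \<in> set xs \<and> v \<in> set xs"
  by (auto simp: consecutive_def)

lemma consecutive_unique:
  assumes "distinct xs"
  shows "consecutive xs u v \<Longrightarrow> consecutive xs u w \<Longrightarrow> v = w"
    and "consecutive xs v u \<Longrightarrow> consecutive xs w u \<Longrightarrow> v = w"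
proof -
  show "v = w" if uv: "consecutive xs u v" "consecutive xs u w"
  proof -
    obtain l r l' r' where xs: "xs = l @ u # v # r" "xs = l' @ u # w # r'"
      using uv unfolding consecutive_def by blast
    then have "u \<notin> set l" "u \<notin> set (v # r)" using assms by auto
    then have "v # r = w # r'" using xs append_Cons_eq_iff[of u l "v # r" l' "w # r'"] by auto
    then show ?thesis by simp
  qed
  show "v = w" if vu: "consecutive xs v u" "consecutive xs w u"
  proof -
    obtain l r l' r' where "xs = l @ v # u # r" "xs = l' @ w # u # r'"
      using vu unfolding consecutive_def by blast
    then have xs: "xs = (l @ [v]) @ u # r" "xs = (l' @ [w]) @ u # r'" by simp_all
    then have "u \<notin> set (l @ [v])" "u \<notin> set r"
      using assms by auto
    then have "l @ [v] = l' @ [w]" using xs append_Cons_eq_iff[of u "l @ [v]" r "l' @ [w]" r'] by auto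
    then show ?thesis by simp
  qed
qed

lemma split_two:
  assumes "p \<in> set xs" "q \<in> set xs" "p \<noteq> q"
  shows "(\<exists>l m r. xs = l @ p # m @ q # r) \<or> (\<exists>l m r. xs = l @ q # m @ p # r)"
proof -
  obtain l r where xs: "xs = l @ p # r" using assms(1) by (meson split_list)
  then have "q \<in> set l \<or> q \<in> set r" using assms by auto
  then show ?thesis
  proof
    assume "q \<in> set l"
    then obtain l1 l2 where "l = l1 @ q # l2" by (meson split_list)
    then have "xs = l1 @ q # l2 @ p # r" using xs by simp
    then show ?thesis by blast
  next
    assume "q \<in> set r"
    then obtain l1 l2 where "r = l1 @ q # l2" by (meson split_list)
    then show ?thesis using xs by blast
  qed
qed

text \<open>Induction with the last colour fixed: the second entry gets a third colour, different
  from both \<alpha> and \<beta>, so that the tail again starts and ends with different colours.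
  This is where three colours are needed.\<close>

lemma alternating_colouring:
  fixes K :: "'c set"
  assumes "card K \<ge> 3" "finite K" "\<alpha> \<in> K" "\<beta> \<in> K" "\<alpha> \<noteq> \<beta>" "distinct xs" "length xs \<ge> 2"
  shows "\<exists>g. g (hd xs) = \<alpha> \<and> g (last xs) = \<beta> \<and> range g \<subseteq> K \<and> successively (\<lambda>u v. g u \<noteq> g v) xs"
  using assms(3-)
proof (induction xs arbitrary: \<alpha> rule: induct_list012)
  case (3 u v xs)
  show ?case
  proof (cases xs)
    case Nil
    then show ?thesis using 3 by (intro exI[of _ "\<lambda>w. if w = u then \<alpha> else \<beta>"]) auto
  next
    case (Cons w ws)
    have "card (K - {\<alpha>, \<beta>}) > 0"
      using assms(1,2) "3.prems" by (simp add: card_Diff_subset)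
    then obtain \<delta> where \<delta>: "\<delta> \<in> K" "\<delta> \<noteq> \<alpha>" "\<delta> \<noteq> \<beta>" by (fastforce simp: card_gt_0_iff)
    obtain g where g: "g v = \<delta>" "g (last (v # xs)) = \<beta>" "range g \<subseteq> K"
      "successively (\<lambda>u v. g u \<noteq> g v) (v # xs)"
      using "3.IH"(2)[of \<delta>] \<delta> "3.prems" Cons by auto
    have "u \<notin> set (v # xs)" using "3.prems" by simp
    then have "successively (\<lambda>a b. (g(u := \<alpha>)) a \<noteq> (g(u := \<alpha>)) b) (v # xs)"
      using g(4) by (intro successively_mono[OF g(4)]) auto
    then show ?thesis
      using g \<delta> "3.prems" Cons \<open>u \<notin> set (v # xs)\<close> by (intro exI[of _ "g(u := \<alpha>)"]) auto
  qed
qed auto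

section \<open>Links outside a vertex set\<close>

locale bipartite_graph =
  fixes A B :: "'a set" and E :: "('a \<times> 'a) set"
  assumes fin: "finite (A \<union> B)" and disj: "A \<inter> B = {}"
    and bip: "E \<subseteq> A \<times> B \<union> B \<times> A" and sym: "sym E"
begin

lemma symE: "(u, v) \<in> E \<Longrightarrow> (v, u) \<in> E"
  using sym by (rule symD)

lemma edge_cases: "(u, v) \<in> E \<Longrightarrow> u \<in> A \<and> v \<in> B \<and> u \<notin> B \<and> v \<notin> A \<or> u \<in> B \<and> v \<in> A \<and> u \<notin> A \<and> v \<notin> B"
  using bip disj by blast

lemma upath_rev: "upath E (rev xs) \<longleftrightarrow> upath E xs"
  unfolding successively_rev by (rule successively_cong[OF _ refl]) (auto intro: symE)

text \<open>A link between two vertices of \<open>W\<close> witnesses that a component of the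
  complement of \<open>W\<close> is attached to both. Vertices of \<open>zs\<close> may repeat, so
  that links can be concatenated freely.\<close>

definition link :: "'a set \<Rightarrow> 'a \<Rightarrow> 'a \<Rightarrow> 'a list \<Rightarrow> bool" where
  "link W x y zs \<longleftrightarrow> zs \<noteq> [] \<and> set zs \<inter> W = {} \<and> upath E (x # zs @ [y])"

lemma link_rev: "link W x y zs \<Longrightarrow> link W y x (rev zs)"
  using upath_rev[of "x # zs @ [y]"] by (simp add: link_def)

lemma link_mono: "link W x y zs \<Longrightarrow> W' \<subseteq> W \<Longrightarrow> link W' x y zs"
  by (auto simp: link_def)

lemma link_append:
  "link W x u xs \<Longrightarrow> link W u y ys \<Longrightarrow> u \<notin> W \<Longrightarrow> link W x y (xs @ u # ys)"
  by (auto simp: link_def successively_append_iff successively_Cons)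

lemma link_Cons: "(x, u) \<in> E \<Longrightarrow> link W u y ys \<Longrightarrow> u \<notin> W \<Longrightarrow> link W x y (u # ys)"
  by (auto simp: link_def successively_append_iff successively_Cons)

lemma link_single: "(x, u) \<in> E \<Longrightarrow> (u, y) \<in> E \<Longrightarrow> u \<notin> W \<Longrightarrow> link W x y [u]"
  by (auto simp: link_def)

lemma link_prefix:
  assumes "link W x y zs" "z \<in> set zs"
  shows "(x, z) \<in> E \<or> (\<exists>us. link W x z us)"
proof -
  obtain us vs where zs: "zs = us @ z # vs" using assms(2) by (meson split_list)
  show ?thesis
  proof (cases "us = []")
    case True
    then show ?thesis using assms(1) zs by (auto simp: link_def)
  next
    case False
    then have "link W x z us"
      using assms(1) zs by (auto simp: link_def successively_append_iff successively_Cons)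
    then show ?thesis by blast
  qed
qed

definition shortest_link :: "'a set \<Rightarrow> 'a \<Rightarrow> 'a \<Rightarrow> 'a list \<Rightarrow> bool" where
  "shortest_link W x y zs \<longleftrightarrow> link W x y zs \<and> (\<forall>us. link W x y us \<longrightarrow> length zs \<le> length us)"

lemma shortest_link_exists: "link W x y zs \<Longrightarrow> \<exists>us. shortest_link W x y us"
  unfolding shortest_link_def using ex_has_least_nat[of "link W x y" zs length] by blast

text \<open>A chord cuts out \<open>m\<close> and leaves a shorter link, unless it joins
  \<open>x\<close> and \<open>y\<close> themselves: then the shortcut has no inner vertex and is not
  a link.\<close>

lemma shortest_link_chordless:
  assumes "shortest_link W x y zs" "x # zs @ [y] = l @ u # m @ v # r" "(u, v) \<in> E"
  shows "m = [] \<or> l = [] \<and> r = []"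
proof (rule ccontr)
  assume contra: "\<not> ?thesis"
  then have "m \<noteq> []" by simp
  have link: "link W x y zs" and min: "\<And>us. link W x y us \<Longrightarrow> length zs \<le> length us"
    using assms(1) by (auto simp: shortest_link_def)
  define zs' where "zs' = butlast (tl (l @ u # v # r))"
  have new: "x # zs' @ [y] = l @ u # v # r \<and> set zs' \<subseteq> set zs \<and> zs' \<noteq> [] \<and> length zs' < length zs"
  proof (cases l)
    case Nil
    then obtain r' where "r = r' @ [y]"
      using contra assms(2) by (cases r rule: rev_cases) auto
    then show ?thesis using Nil assms(2) \<open>m \<noteq> []\<close> by (auto simp: zs'_def butlast_append)
  next
    case (Cons a l')
    show ?thesis
    proof (cases r rule: rev_cases)
      case Nil
      then have "zs @ [y] = (l' @ u # m) @ [v]" using Cons assms(2) by simp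
      then have "zs = l' @ u # m" "v = y" by (simp_all only: append1_eq_conv)
      then show ?thesis using Nil Cons assms(2) \<open>m \<noteq> []\<close> by (auto simp: zs'_def butlast_append)
    next
      case (snoc r' b)
      then have "zs @ [y] = (l' @ u # m @ v # r') @ [b]" using Cons assms(2) by simp
      then have "zs = l' @ u # m @ v # r'" "b = y" by (simp_all only: append1_eq_conv)
      then show ?thesis using snoc Cons assms(2) \<open>m \<noteq> []\<close> by (auto simp: zs'_def butlast_append)
    qed
  qed
  have "upath E (l @ u # m @ v # r)" using link assms(2) by (simp add: link_def)
  then have "upath E (l @ u # v # r)"
    using assms(3) by (auto simp: successively_append_iff successively_Cons)
  then have "link W x y zs'" using new link by (auto simp: link_def)
  then show False using min new by fastforce
qed

text \<open>If a vertex occurred twice, its first occurrence would have a chord to the successor of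
  its second one.\<close>

lemma shortest_link_distinct:
  assumes "shortest_link W x y zs" "x \<in> W" "y \<in> W" "x \<noteq> y"
  shows "distinct (x # zs @ [y])"
proof (rule ccontr)
  have link: "link W x y zs" using assms(1) by (simp add: shortest_link_def)
  assume "\<not> ?thesis"
  moreover have "x \<notin> set zs" "y \<notin> set zs" using link assms by (auto simp: link_def)
  ultimately have "\<not> distinct zs" using assms(4) by auto
  then obtain l m r u where "zs = l @ [u] @ m @ [u] @ r" using not_distinct_decomp by blast
  then obtain v r' where z: "x # zs @ [y] = (x # l) @ u # (m @ [u]) @ v # r'" and v: "v = hd (r @ [y])"
    by (cases r) auto
  have "upath E ((x # l) @ u # (m @ [u]) @ v # r')" using link unfolding link_def z[symmetric] by simp
  then have "(u, v) \<in> E" by (auto simp: successively_append_iff successively_Cons)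
  then show False using shortest_link_chordless[OF assms(1) z] by simp
qed

text \<open>Every component of the complement of \<open>W\<close> is attached to \<open>W\<close> at a clique, that is, at no
  vertex, one vertex or the two ends of an edge.\<close>

definition clique_attached :: "'a set \<Rightarrow> bool" where
  "clique_attached W \<longleftrightarrow> (\<forall>x \<in> W. \<forall>y \<in> W. \<forall>zs. link W x y zs \<longrightarrow> x = y \<or> (x, y) \<in> E)"

text \<open>A partial proper colouring of the graph that joins vertices of \<open>B\<close> with a
  common neighbour. The common neighbour counts only once it is in \<open>W\<close>, so adding
  vertices of \<open>A\<close> can create constraints too.\<close>

definition strong_colouring :: "'c set \<Rightarrow> 'a set \<Rightarrow> ('a \<Rightarrow> 'c) \<Rightarrow> bool" where
  "strong_colouring K W f \<longleftrightarrow> f ` (B \<inter> W) \<subseteq> K \<and>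
     (\<forall>a \<in> A \<inter> W. \<forall>b \<in> B \<inter> W. \<forall>b' \<in> B \<inter> W. (a, b) \<in> E \<and> (a, b') \<in> E \<and> b \<noteq> b' \<longrightarrow> f b \<noteq> f b')"

lemma clique_attachedD: "clique_attached W \<Longrightarrow> x \<in> W \<Longrightarrow> y \<in> W \<Longrightarrow> link W x y zs \<Longrightarrow> x = y \<or> (x, y) \<in> E"
  by (auto simp: clique_attached_def)

text \<open>If \<open>p\<close> and \<open>q\<close> were not adjacent, the two arcs of the cycle between them and the ear would
  form a theta.\<close>

lemma cycle_ear:
  assumes "theta_free E" and z: "distinct (x # zs @ [y])" "upath E (x # zs @ [y])" "(x, y) \<in> E"
    and "x # zs @ [y] = l @ p # m @ q # r" "link (insert x (insert y (set zs))) p q us"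
  shows "(p, q) \<in> E"
proof (rule ccontr)
  assume pq: "(p, q) \<notin> E"
  let ?W = "insert x (insert y (set zs))"
  let ?z = "x # zs @ [y]"
  have W: "?W = set ?z" by auto
  have dist: "distinct (l @ p # m @ q # r)" and up: "upath E (l @ p # m @ q # r)"
    using z(1,2) unfolding assms(5) .
  have ends: "hd (l @ [p]) = x" "last (q # r) = y"
  proof -
    show "hd (l @ [p]) = x" using assms(5) by (cases l) auto
    have "last (l @ p # m @ q # r) = y" using assms(5) by (metis last_ConsR last_snoc append_is_Nil_conv not_Cons_self2)
    then show "last (q # r) = y" by simp
  qed
  \<comment> \<open>The given ear may repeat vertices; a shortest one is a path.\<close>
  obtain vs where vs: "shortest_link ?W p q vs" using shortest_link_exists assms(6) by blast
  have "p \<in> ?W" "q \<in> ?W" "p \<noteq> q" using dist unfolding W assms(5) by auto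
  then have vs_dist: "distinct (p # vs @ [q])" using shortest_link_distinct[OF vs] by blast
  have vs_up: "upath E (p # vs @ [q])" and vs_ne: "vs \<noteq> []" and "set vs \<inter> set ?z = {}"
    using vs by (auto simp: shortest_link_def link_def)
  then have vs_disj: "set vs \<inter> set (l @ p # m @ q # r) = {}" unfolding assms(5) by simp
  \<comment> \<open>The inner vertices of the arc of the cycle that runs from \<open>p\<close> back
    to \<open>x\<close>, across the edge \<open>xy\<close>, and from \<open>y\<close> back to
    \<open>q\<close>.\<close>
  let ?b = "rev l @ rev r"
  have "upath E (rev (l @ [p]))" unfolding upath_rev using up by (auto simp: successively_append_iff successively_Cons)
  moreover have "upath E (rev (q # r))" unfolding upath_rev using up by (auto simp: successively_append_iff successively_Cons)
  ultimately have "upath E (rev (l @ [p]) @ rev (q # r))"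
    using z(3) ends unfolding successively_append_iff by (auto simp: last_rev hd_rev simp del: rev.simps rev_append)
  then have b_up: "upath E (p # ?b @ [q])" by simp
  have b_ne: "?b \<noteq> []" using pq z(3) ends by auto
  have m_up: "upath E (p # m @ [q])"
  proof -
    have "upath E (l @ (p # m @ [q]) @ r)" using up by simp
    then show ?thesis by (simp only: successively_append_iff[of _ l] successively_append_iff[of _ "p # m @ [q]"])
  qed
  have m_ne: "m \<noteq> []" using m_up pq by auto
  have "distinct (p # m @ [q])" "distinct (p # ?b @ [q])" "set m \<inter> set ?b = {}"
    "set ?b \<inter> set vs = {}" "set m \<inter> set vs = {}"
    using dist vs_disj by auto
  then show False
    using assms(1) m_up b_up vs_up vs_dist m_ne b_ne vs_ne unfolding theta_free_def by blast
qed

section \<open>Growing the coloured set\<close>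

lemma common_neighbour_eq:
  assumes "q = x \<or> (x, q) \<in> E" "q = y \<or> (y, q) \<in> E" "(x, y) \<in> E"
  shows "q = x \<or> q = y"
  \<comment> \<open>A vertex adjacent to both ends of the edge \<open>xy\<close> would close a
    triangle.\<close>
  using assms edge_cases by blast

text \<open>Through the component containing \<open>zs\<close>, \<open>w\<close> is linked to
  \<open>x\<close> and to \<open>y\<close>, so it equals or is adjacent to each of them. Without
  triangles only \<open>w = x\<close> and \<open>w = y\<close> remain.\<close>

lemma attached_to_link_ends:
  assumes "clique_attached W" "link W x y zs" "(x, y) \<in> E" "x \<in> W" "y \<in> W" "u \<in> set zs" "w \<in> W"
    and "(u, w) \<in> E \<or> (\<exists>us. link W u w us)"
  shows "w = x \<or> w = y"
proof -
  have uW: "u \<notin> W" using assms by (auto simp: link_def)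
  have "w = s \<or> (s, w) \<in> E" if s: "s \<in> W" "(s, u) \<in> E \<or> (\<exists>us. link W s u us)" for s
  proof -
    have "\<exists>us. link W s w us"
      using s(2) assms(8) uW link_Cons[of s u W w] link_single[of s u w W] link_append[of W s u _ w]
        link_rev[OF link_Cons[of w u W s]] link_rev[of W s u] symE by blast
    then show ?thesis using clique_attachedD[OF assms(1) s(1) assms(7)] by blast
  qed
  moreover have "(x, u) \<in> E \<or> (\<exists>us. link W x u us)" using link_prefix assms by blast
  moreover have "(y, u) \<in> E \<or> (\<exists>us. link W y u us)" using link_prefix[OF link_rev[OF assms(2)]] assms by simp
  ultimately show ?thesis using common_neighbour_eq assms by blast
qed

text \<open>A link with an end on \<open>zs\<close> has both ends on the cycle formed by
  \<open>zs\<close> and the edge \<open>xy\<close>, because the old attachment allows no other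
  vertices of \<open>W\<close>. It is thus an ear of this cycle, and \<open>cycle_ear\<close>
  applies in one of the two orientations.\<close>

lemma clique_attached_add_link:
  assumes "theta_free E" "clique_attached W" "shortest_link W x y zs" "(x, y) \<in> E" "x \<in> W" "y \<in> W"
  shows "clique_attached (W \<union> set zs)"
  unfolding clique_attached_def
proof (intro ballI allI impI)
  fix p q us
  assume p: "p \<in> W \<union> set zs" and q: "q \<in> W \<union> set zs" and us: "link (W \<union> set zs) p q us"
  have link: "link W x y zs" using assms(3) by (simp add: shortest_link_def)
  have "x \<noteq> y" using edge_cases[OF assms(4)] by blast
  have dist: "distinct (x # zs @ [y])" using shortest_link_distinct assms \<open>x \<noteq> y\<close> by blast
  have us': "link W p q us" using us link_mono by blast
  show "p = q \<or> (p, q) \<in> E"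
  proof (cases "p \<in> W \<and> q \<in> W")
    case True
    then show ?thesis using clique_attachedD us' assms(2) by blast
  next
    case False
    have "q \<in> W \<Longrightarrow> p \<in> set zs \<Longrightarrow> q = x \<or> q = y"
      using attached_to_link_ends[OF assms(2) link assms(4,5,6)] us' by blast
    moreover have "p \<in> W \<Longrightarrow> q \<in> set zs \<Longrightarrow> p = x \<or> p = y"
      using attached_to_link_ends[OF assms(2) link assms(4,5,6)] link_rev[OF us'] by blast
    ultimately have pq: "p \<in> set (x # zs @ [y])" "q \<in> set (x # zs @ [y])"
      using p q False by auto
    have ear: "link (insert x (insert y (set zs))) p q us"
      by (rule link_mono[OF us]) (use assms(5,6) in auto)
    have up: "upath E (x # zs @ [y])" using link by (simp add: link_def)
    show ?thesis
    proof (cases "p = q")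
      case False
      then show ?thesis
        using split_two[OF pq] cycle_ear[OF assms(1) dist up assms(4) _ ear]
          cycle_ear[OF assms(1) dist up assms(4) _ link_rev[OF ear]] symE by blast
    qed simp
  qed
qed

text \<open>By attachment \<open>w\<close> is on the cycle, and a shortest link has no chord other
  than \<open>xy\<close>, of which \<open>u\<close> is not an end.\<close>

lemma link_edges_consec:
  assumes "clique_attached W" "shortest_link W x y zs" "(x, y) \<in> E" "x \<in> W" "y \<in> W"
    and "u \<in> set zs" "w \<in> W \<union> set zs" "(u, w) \<in> E"
  shows "consecutive (x # zs @ [y]) u w \<or> consecutive (x # zs @ [y]) w u"
proof -
  have link: "link W x y zs" using assms(2) by (simp add: shortest_link_def)
  have dist: "distinct (x # zs @ [y])"
    using shortest_link_distinct assms edge_cases[OF assms(3)] by blast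
  have "w \<in> set (x # zs @ [y])"
    using attached_to_link_ends[OF assms(1) link assms(3-6)] assms(7,8) by auto
  moreover have "u \<noteq> w" using edge_cases[OF assms(8)] by blast
  ultimately consider l m r where "x # zs @ [y] = l @ u # m @ w # r"
    | l m r where "x # zs @ [y] = l @ w # m @ u # r"
    using split_two[of u "x # zs @ [y]" w] assms(6) by auto
  then show ?thesis
  proof cases
    case 1
    moreover have "l \<noteq> []"
    proof
      assume "l = []"
      then have "x = u" using 1 by simp
      then show False using assms(6) dist by simp
    qed
    ultimately have "m = []" using shortest_link_chordless[OF assms(2) 1 assms(8)] by simp
    then show ?thesis using 1 unfolding consecutive_def by auto
  next
    case 2
    moreover have "r \<noteq> []"
    proof
      assume "r = []"
      then have "x # zs @ [y] = (l @ w # m) @ [u]" using 2 by simp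
      then have "last (x # zs @ [y]) = last ((l @ w # m) @ [u])" by simp
      then have "y = u" by simp
      then show False using assms(6) dist by auto
    qed
    ultimately have "m = []" using shortest_link_chordless[OF assms(2) 2 symE[OF assms(8)]] by simp
    then show ?thesis using 2 unfolding consecutive_def by auto
  qed
qed

text \<open>The neighbour \<open>w\<close> lies outside \<open>W\<close>, so at most
  \<open>card K - 1\<close> neighbours of \<open>a\<close> are in \<open>W\<close>.\<close>

lemma free_colour:
  assumes "finite K" "card {b. (a, b) \<in> E} \<le> card K" "(a, w) \<in> E" "w \<notin> W"
  shows "\<exists>\<alpha> \<in> K. \<alpha> \<notin> f ` ({b. (a, b) \<in> E} \<inter> W)"
proof -
  have finite_nbs: "finite {b. (a, b) \<in> E}"
    by (rule finite_subset[OF _ fin]) (use edge_cases in blast)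
  have "card (f ` ({b. (a, b) \<in> E} \<inter> W)) \<le> card ({b. (a, b) \<in> E} \<inter> W)"
    using finite_nbs by (intro card_image_le) auto
  also have "\<dots> < card {b. (a, b) \<in> E}"
    using finite_nbs assms by (intro psubset_card_mono) auto
  also have "\<dots> \<le> card K" by fact
  finally have "\<not> K \<subseteq> f ` ({b. (a, b) \<in> E} \<inter> W)"
    using finite_nbs by (meson card_mono finite_Int finite_imageI leD)
  then show ?thesis by blast
qed

text \<open>New conflicts arise only at \<open>x\<close>, between the first vertex \<open>b\<close>
  of the link and the coloured neighbours of \<open>x\<close>, and at vertices of \<open>A\<close>
  on the link, between the two vertices of \<open>B\<close> beside them. A colour \<alpha> free at
  \<open>x\<close> settles the former; an alternating colouring from \<alpha> to the old colour of
  \<open>y\<close> settles the latter.\<close>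

lemma strong_colouring_add_link:
  assumes "clique_attached W" "strong_colouring K W f" "shortest_link W x y zs" "(x, y) \<in> E" "x \<in> W" "y \<in> W" "x \<in> A"
    and K: "finite K" "card K \<ge> 3" "card {b. (x, b) \<in> E} \<le> card K"
  shows "\<exists>f'. strong_colouring K (W \<union> set zs) f'"
proof -
  let ?z = "x # zs @ [y]"
  have link: "link W x y zs" using assms(3) by (simp add: shortest_link_def)
  have y: "y \<in> B" "x \<notin> B" using edge_cases[OF assms(4)] assms(7) disj by blast+
  then have dist: "distinct ?z" using shortest_link_distinct[OF assms(3,5,6)] assms(7) by blast
  obtain b zs' where zs: "zs = b # zs'" using link by (cases zs) (auto simp: link_def)
  have xb: "(x, b) \<in> E" using link zs by (auto simp: link_def)
  have bW: "b \<notin> W" using link zs by (auto simp: link_def)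
  have bB: "b \<in> B" using edge_cases[OF xb] assms(7) disj by blast
  obtain \<alpha> where \<alpha>: "\<alpha> \<in> K" "\<alpha> \<notin> f ` ({b. (x, b) \<in> E} \<inter> W)"
    using free_colour[OF K(1,3) xb bW, of f] by blast
  let ?bs = "filter (\<lambda>v. v \<in> B) ?z"
  have bs: "hd ?bs = b" "last ?bs = y" "length ?bs \<ge> 2" "distinct ?bs"
    using dist zs bB y by auto
  \<comment> \<open>\<open>y\<close> is itself a coloured neighbour of \<open>x\<close>, so \<alpha>
    avoids its colour.\<close>
  have "f y \<in> K" "\<alpha> \<noteq> f y" using assms y \<alpha> by (auto simp: strong_colouring_def)
  then obtain g where g: "g b = \<alpha>" "g y = f y" "range g \<subseteq> K" "successively (\<lambda>u v. g u \<noteq> g v) ?bs"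
    using alternating_colouring[OF K(2,1) \<alpha>(1) _ _ bs(4,3), of "f y"] bs(1,2) by metis
  define f' where "f' v = (if v \<in> W then f v else g v)" for v
  have f'_z: "f' v = g v" if "v \<in> B" "v \<in> set ?z" for v
    using that y g(2) link by (auto simp: f'_def link_def)
  have range: "f' ` (B \<inter> (W \<union> set zs)) \<subseteq> K"
    using assms(2) g(3) by (auto simp: f'_def strong_colouring_def)
  \<comment> \<open>Dropping the vertices outside \<open>B\<close> from the path makes
    \<open>u\<close> and \<open>v\<close> neighbours in \<open>?bs\<close>.\<close>
  have triple: "g u \<noteq> g v" if uav: "consecutive ?z u a" "consecutive ?z a v" "u \<in> B" "a \<in> A" "v \<in> B" for u a v
  proof -
    obtain l r where l: "?z = l @ u # a # r" using uav(1) by (auto simp: consecutive_def)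
    obtain l' r' where l': "?z = l' @ a # v # r'" using uav(2) by (auto simp: consecutive_def)
    have "(l @ [u]) @ a # r = l' @ a # (v # r')" using l l' by simp
    moreover have "a \<notin> set (l @ [u])" "a \<notin> set r" using dist unfolding l by auto
    ultimately have "r = v # r'" by (subst (asm) append_Cons_eq_iff) auto
    moreover have "a \<notin> B" using uav(4) disj by blast
    ultimately have "?bs = filter (\<lambda>v. v \<in> B) l @ u # v # filter (\<lambda>v. v \<in> B) r'"
      unfolding l using uav by simp
    then show ?thesis using g(4) by (simp only: successively_append_iff successively.simps) simp
  qed
  have nb_x: "w = b" if "w \<in> set zs" "(x, w) \<in> E" for w
  proof -
    have "consecutive ?z w x \<or> consecutive ?z x w"
      using link_edges_consec[OF assms(1,3-6) that(1), of x] that symE assms(5) by blast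
    moreover have "consecutive ?z x b" using zs unfolding consecutive_def by (intro exI[of _ "[]"] exI[of _ "zs' @ [y]"]) simp
    moreover have "\<not> consecutive ?z w x"
    proof
      assume "consecutive ?z w x"
      then obtain l r where "?z = l @ w # x # r" by (auto simp: consecutive_def)
      then show False using dist by (cases l) auto
    qed
    ultimately show ?thesis using consecutive_unique(1)[OF dist] by blast
  qed
  have "f' u \<noteq> f' v"
    if a: "a \<in> A" "a \<in> W \<union> set zs" and u: "u \<in> B" "u \<in> W \<union> set zs" "(a, u) \<in> E"
      and v: "v \<in> B" "v \<in> W \<union> set zs" "(a, v) \<in> E" and "u \<noteq> v" for a u v
  proof (cases "a \<in> set zs")
    case True
    have "consecutive ?z a u \<or> consecutive ?z u a" "consecutive ?z a v \<or> consecutive ?z v a"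
      using link_edges_consec[OF assms(1,3-6) True] u v by blast+
    then have *: "consecutive ?z u a \<and> consecutive ?z a v \<or> consecutive ?z v a \<and> consecutive ?z a u"
      using consecutive_unique[OF dist] \<open>u \<noteq> v\<close> by blast
    then have "g u \<noteq> g v" using triple[OF _ _ u(1) a(1) v(1)] triple[OF _ _ v(1) a(1) u(1)] by metis
    moreover have "u \<in> set ?z" "v \<in> set ?z" using * consecutive_in_set by metis+
    ultimately show ?thesis using f'_z u v by simp
  next
    case False
    then have aW: "a \<in> W" using a by blast
    \<comment> \<open>The other end \<open>y\<close> is excluded since it lies in
      \<open>B\<close>.\<close>
    have into_zs: "a = x" if "w \<in> B" "w \<in> set zs" "(a, w) \<in> E" for w
      using attached_to_link_ends[OF assms(1) link assms(4-6) that(2) aW] that symE y(1) a(1) disj by blast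
    have fresh: "f' c \<noteq> f' d" if "c \<in> set zs" "d \<in> W \<union> set zs" "c \<in> B" "(a, c) \<in> E" "(a, d) \<in> E" "c \<noteq> d" for c d
    proof -
      have "a = x" using into_zs that by blast
      then have "c = b" using nb_x that by blast
      moreover have "d \<in> W" using nb_x that \<open>a = x\<close> \<open>c = b\<close> by blast
      ultimately show ?thesis using \<alpha>(2) that g(1) bW \<open>a = x\<close> by (auto simp: f'_def)
    qed
    show ?thesis
    proof (cases "u \<in> W \<and> v \<in> W")
      case True
      then show ?thesis using assms(2) a aW u v \<open>u \<noteq> v\<close> by (auto simp: f'_def strong_colouring_def)
    next
      case False
      then show ?thesis using fresh[of u v] fresh[of v u] u v \<open>u \<noteq> v\<close> by fastforce
    qed
  qed
  then have "strong_colouring K (W \<union> set zs) f'" using range unfolding strong_colouring_def by blast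
  then show ?thesis by blast
qed

text \<open>If \<open>w\<close> has a neighbour \<open>x\<close> in \<open>W\<close>, its component
  is attached to \<open>W\<close> at \<open>x\<close> only, so every link from \<open>w\<close> to
  \<open>W\<close> ends at a neighbour of \<open>w\<close>. In the other case no edge leaves
  \<open>W\<close>, and there are no such links.\<close>

lemma clique_attached_insert:
  assumes "\<And>x y zs. x \<in> W \<Longrightarrow> y \<in> W \<Longrightarrow> link W x y zs \<Longrightarrow> x = y" "w \<notin> W"
    and "(\<exists>x \<in> W. (x, w) \<in> E) \<or> (\<forall>x \<in> W. \<forall>v. v \<notin> W \<longrightarrow> (x, v) \<notin> E)"
  shows "clique_attached (insert w W)"
  unfolding clique_attached_def
proof (intro ballI allI impI)
  fix p q us
  assume p: "p \<in> insert w W" and q: "q \<in> insert w W" and us: "link (insert w W) p q us"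
  have *: "(w, y) \<in> E" if "y \<in> W" "link (insert w W) w y us" for y us
  proof -
    have l: "link W w y us" using that link_mono by blast
    then have e: "(last us, y) \<in> E" "us \<noteq> []" "set us \<inter> W = {}"
      by (auto simp: link_def successively_append_iff successively_Cons)
    then have "last us \<notin> W" using last_in_set[of us] by blast
    then obtain x where x: "x \<in> W" "(x, w) \<in> E" using assms(3) \<open>y \<in> W\<close> symE[OF e(1)] by blast
    have "x = y" by (rule assms(1)[OF x(1) that(1) link_Cons[OF x(2) l assms(2)]])
    then show ?thesis using symE[OF x(2)] by blast
  qed
  show "p = q \<or> (p, q) \<in> E"
  proof (cases "p \<in> W \<and> q \<in> W")
    case True
    then show ?thesis using assms(1) link_mono[OF us] by blast
  next
    case False
    then show ?thesis using p q us *[of q us] *[of p "rev us"] link_rev[OF us] symE by auto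
  qed
qed

text \<open>Two neighbours of \<open>w\<close> in \<open>W\<close> would be joined by the link
  \<open>[w]\<close>, so there is at most one. For \<open>w\<close> in \<open>A\<close> no new
  constraint arises; for \<open>w\<close> in \<open>B\<close> a colour free at that neighbour
  works.\<close>

lemma strong_colouring_insert:
  assumes "\<And>x y zs. x \<in> W \<Longrightarrow> y \<in> W \<Longrightarrow> link W x y zs \<Longrightarrow> x = y" "w \<notin> W" "strong_colouring K W f"
    and K: "finite K" "K \<noteq> {}" "\<And>a. a \<in> A \<Longrightarrow> card {b. (a, b) \<in> E} \<le> card K"
  shows "\<exists>f'. strong_colouring K (insert w W) f'"
proof -
  have unique: "x = y" if "x \<in> W" "y \<in> W" "(x, w) \<in> E" "(y, w) \<in> E" for x y
    using assms(1)[OF that(1,2) link_single] that assms(2) symE by blast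
  have "\<exists>\<alpha> \<in> K. \<forall>a \<in> A \<inter> W. (a, w) \<in> E \<longrightarrow> \<alpha> \<notin> f ` ({b. (a, b) \<in> E} \<inter> W)"
  proof (cases "\<exists>a \<in> A \<inter> W. (a, w) \<in> E")
    case True
    then obtain a where a: "a \<in> A" "a \<in> W" "(a, w) \<in> E" by blast
    then show ?thesis using free_colour[OF K(1) K(3)[OF a(1)] a(3) assms(2), of f] unique by blast
  next
    case False
    then show ?thesis using K(2) by blast
  qed
  then obtain \<alpha> where \<alpha>: "\<alpha> \<in> K" "\<And>a. a \<in> A \<inter> W \<Longrightarrow> (a, w) \<in> E \<Longrightarrow> \<alpha> \<notin> f ` ({b. (a, b) \<in> E} \<inter> W)"
    by blast
  have "strong_colouring K (insert w W) (f(w := \<alpha>))"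
    unfolding strong_colouring_def
  proof (intro conjI ballI impI)
    show "(f(w := \<alpha>)) ` (B \<inter> insert w W) \<subseteq> K" using \<alpha>(1) assms(3) by (auto simp: strong_colouring_def)
    fix a b b'
    assume a: "a \<in> A \<inter> insert w W" and b: "b \<in> B \<inter> insert w W" "b' \<in> B \<inter> insert w W"
      and e: "(a, b) \<in> E \<and> (a, b') \<in> E \<and> b \<noteq> b'"
    show "(f(w := \<alpha>)) b \<noteq> (f(w := \<alpha>)) b'"
    proof (cases "a = w")
      case True
      then have "b \<in> W" "b' \<in> W" using a b disj by auto
      then show ?thesis using unique e True symE by blast
    next
      case False
      then have aW: "a \<in> A \<inter> W" using a by blast
      then have "b \<in> W \<Longrightarrow> b' \<in> W \<Longrightarrow> f b \<noteq> f b'" using assms(3) b e by (auto simp: strong_colouring_def)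
      moreover have "(a, w) \<in> E \<Longrightarrow> (a, v) \<in> E \<Longrightarrow> v \<in> W \<Longrightarrow> \<alpha> \<noteq> f v" for v using \<alpha>(2)[OF aW] by blast
      ultimately show ?thesis using b e assms(2) by (auto split: if_splits)
    qed
  qed
  then show ?thesis by blast
qed

lemma strong_colouring_extend:
  assumes "theta_free E" "clique_attached W" "strong_colouring K W f" "W \<subset> A \<union> B"
    and K: "finite K" "card K \<ge> 3" "\<And>a. a \<in> A \<Longrightarrow> card {b. (a, b) \<in> E} \<le> card K"
  shows "\<exists>W' f'. W \<subset> W' \<and> W' \<subseteq> A \<union> B \<and> clique_attached W' \<and> strong_colouring K W' f'"
proof (cases "\<exists>x \<in> W. \<exists>y \<in> W. \<exists>zs. link W x y zs \<and> x \<noteq> y")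
  case True
  then obtain x y zs where xy: "x \<in> W" "y \<in> W" "link W x y zs" "x \<noteq> y" by blast
  then have "(x, y) \<in> E" using clique_attachedD[OF assms(2)] by blast
  \<comment> \<open>The edge joins the two sides, so reversing the link if necessary puts its first
    end in \<open>A\<close>, where the degree bound holds.\<close>
  then obtain x y zs where xy: "x \<in> W" "y \<in> W" "link W x y zs" "(x, y) \<in> E" "x \<in> A"
    using xy edge_cases link_rev symE by meson
  obtain us where us: "shortest_link W x y us" using shortest_link_exists xy(3) by blast
  have "us \<noteq> []" "set us \<inter> W = {}" "upath E (x # us @ [y])"
    using us by (auto simp: shortest_link_def link_def)
  moreover have "u \<in> A \<union> B" if u: "u \<in> set us" for u
  proof -
    have l: "link W x y us" using us by (simp add: shortest_link_def)
    obtain l r where lr: "us = l @ u # r" using u by (meson split_list)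
    then have "(u, hd (r @ [y])) \<in> E"
      using l by (auto simp: link_def successively_append_iff successively_Cons split: if_splits)
    then show ?thesis using edge_cases by blast
  qed
  ultimately have "W \<subset> W \<union> set us" "W \<union> set us \<subseteq> A \<union> B" using assms(4) by (auto simp: neq_Nil_conv)
  then show ?thesis
    using clique_attached_add_link[OF assms(1,2) us xy(4,1,2)]
      strong_colouring_add_link[OF assms(2,3) us xy(4,1,2,5) K(1,2) K(3)[OF xy(5)]] by blast
next
  case False
  then have no: "\<And>x y zs. x \<in> W \<Longrightarrow> y \<in> W \<Longrightarrow> link W x y zs \<Longrightarrow> x = y" by blast
  \<comment> \<open>When no edge leaves \<open>W\<close>, any remaining vertex will do.\<close>
  obtain w where w: "w \<in> A \<union> B" "w \<notin> W"
    and att: "(\<exists>x \<in> W. (x, w) \<in> E) \<or> (\<forall>x \<in> W. \<forall>v. v \<notin> W \<longrightarrow> (x, v) \<notin> E)"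
  proof (cases "\<exists>x \<in> W. \<exists>v. v \<notin> W \<and> (x, v) \<in> E")
    case True
    then show ?thesis using that edge_cases by (metis UnCI)
  next
    case False
    then show ?thesis using that assms(4) by blast
  qed
  have "K \<noteq> {}" using K(2) by auto
  have "\<exists>f'. strong_colouring K (insert w W) f'"
    by (rule strong_colouring_insert[OF _ w(2) assms(3) K(1) \<open>K \<noteq> {}\<close>]) (fact no, fact K(3))
  moreover have "clique_attached (insert w W)"
    by (rule clique_attached_insert[OF no w(2) att])
  moreover have "W \<subset> insert w W" "insert w W \<subseteq> A \<union> B" using w assms(4) by auto
  ultimately show ?thesis by blast
qed

lemma strong_colouring_exists:
  assumes "theta_free E"
    and K: "finite K" "card K \<ge> 3" "\<And>a. a \<in> A \<Longrightarrow> card {b. (a, b) \<in> E} \<le> card K"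
  shows "\<exists>f. strong_colouring K (A \<union> B) f"
proof -
  \<comment> \<open>A maximal member of this finite family replaces an induction on the growing
    set.\<close>
  define \<W> where "\<W> = {W. W \<subseteq> A \<union> B \<and> clique_attached W \<and> (\<exists>f. strong_colouring K W f)}"
  have "finite \<W>" unfolding \<W>_def using fin by simp
  moreover have "{} \<in> \<W>" by (auto simp: \<W>_def clique_attached_def strong_colouring_def)
  ultimately obtain W where W: "W \<in> \<W>" "\<And>W'. W' \<in> \<W> \<Longrightarrow> W \<subseteq> W' \<Longrightarrow> W = W'"
    using finite_has_maximal[of \<W>] by blast
  obtain f where f: "W \<subseteq> A \<union> B" "clique_attached W" "strong_colouring K W f" using W(1) by (auto simp: \<W>_def)
  have "W = A \<union> B"
  proof (rule ccontr)
    assume "W \<noteq> A \<union> B"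
    then obtain W' f' where "W \<subset> W'" "W' \<subseteq> A \<union> B" "clique_attached W'" "strong_colouring K W' f'"
      using strong_colouring_extend[OF assms(1) f(2,3) _ K] f(1) by blast
    then show False using W(2)[of W'] by (auto simp: \<W>_def)
  qed
  then show ?thesis using f(3) by blast
qed

end
section \<open>From strong colourings to packing colourings\<close>

text \<open>Lengths are integers, so the infimum is at least \<open>Suc d\<close> and the inequality
  stays strict; without any walk the infimum is \<infinity>.\<close>

lemma (in wf_digraph) less_\<mu>_unit:
  assumes "\<And>p. awalk u p v \<Longrightarrow> d < length p"
  shows "ereal (real d) < \<mu> (\<lambda>_. 1) u v"
proof -
  have "awalk_cost (\<lambda>_. 1) p = real (length p)" for p
    by (induction p) (auto simp: awalk_cost_def)
  then have "ereal (real (Suc d)) \<le> \<mu> (\<lambda>_. 1) u v"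
    unfolding \<mu>_def using assms by (intro INF_greatest) (force simp: Suc_le_eq)
  then show ?thesis by (rule less_le_trans[rotated]) simp
qed

theorem theorem2:
  fixes G :: "'a pair_pre_digraph" and k :: nat
  assumes "pair_graph G"
    and "bipartite G"
    and "outerplanar G"
    and "k \<ge> 3"
    and "max_degree G \<le> k"
  shows "S_packing_colorable G (1 # replicate k 3)"
proof -
  interpret pair_graph G by (rule assms(1))
  obtain A B where AB: "A \<union> B = pverts G" "A \<inter> B = {}"
    and "\<forall>(u, v) \<in> parcs G. (u \<in> A \<and> v \<in> B) \<or> (u \<in> B \<and> v \<in> A)"
    using assms(2) by (auto simp: bipartite_def)
  then interpret bip: bipartite_graph A B "parcs G"
    using pair_finite_verts pair_sym_arcs by unfold_locales (auto simp: symmetric_def)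
  \<comment> \<open>These are the colours of radius 3; colour 1, of radius 1, is reserved for
    \<open>A\<close>.\<close>
  define K where "K = {2..k + 1}"
  have K: "finite K" "card K = k" by (auto simp: K_def)
  have degree: "card {b. (a, b) \<in> parcs G} \<le> card K" if "a \<in> A" for a
  proof -
    have "out_arcs (with_proj G) a = Pair a ` {b. (a, b) \<in> parcs G}"
      by (auto simp: out_arcs_def)
    then have "card {b. (a, b) \<in> parcs G} = out_degree (with_proj G) a"
      by (simp add: out_degree_def card_image inj_on_def)
    also have "\<dots> \<le> max_degree G"
      unfolding max_degree_def using that AB pair_finite_verts by (intro Max_ge) auto
    finally show ?thesis using assms(5) K by simp
  qed
  obtain f where f: "bip.strong_colouring K (pverts G) f"
    using bip.strong_colouring_exists[OF outerplanar_theta_free[OF assms(1,3)] K(1) _ degree] K(2) assms(4) AB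
    by auto
  define c where "c v = (if v \<in> A then 1 else f v)" for v
  have c_B: "c b = f b" "f b \<in> K" if "b \<in> B" for b
    using that AB f by (auto simp: c_def bip.strong_colouring_def)
  have gt_1: "1 < length p" if "u \<in> A" "v \<in> A" "u \<noteq> v" "awalk u p v" for u v p
    using that bip.edge_cases by (cases p; cases "tl p") (fastforce simp: awalk_Cons_iff awalk_Nil_iff)+
  \<comment> \<open>Walks of length 1 or 3 change sides. The middle vertex of a walk of length 2 is
    in \<open>A\<close>, so its distinct neighbours \<open>u\<close> and \<open>v\<close> would have
    different colours.\<close>
  have gt_3: "3 < length p" if uv: "u \<in> B" "v \<in> B" "u \<noteq> v" "f u = f v" "awalk u p v" for u v p
  proof (rule ccontr)
    assume "\<not> ?thesis"
    then consider "length p = 0" | "length p = Suc 0" | "length p = Suc (Suc 0)" | "length p = Suc (Suc (Suc 0))"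
      by linarith
    then show False
    proof cases
      case 1
      then show ?thesis using uv by (simp add: awalk_Nil_iff)
    next
      case 2
      then have "(u, v) \<in> parcs G" using uv(5)
        by (auto simp: length_Suc_conv awalk_Cons_iff awalk_Nil_iff)
      then show ?thesis using bip.edge_cases uv by blast
    next
      case 3
      then obtain a where "(u, a) \<in> parcs G" and a: "(a, v) \<in> parcs G" using uv(5)
        by (auto simp: length_Suc_conv awalk_Cons_iff awalk_Nil_iff)
      then have "(a, u) \<in> parcs G" using bip.symE by blast
      moreover have "a \<in> A" using bip.edge_cases[OF a] uv by blast
      ultimately show ?thesis using f uv a AB unfolding bip.strong_colouring_def by blast
    next
      case 4
      then obtain a b where "(u, a) \<in> parcs G" "(a, b) \<in> parcs G" "(b, v) \<in> parcs G" using uv(5)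
        by (auto simp: length_Suc_conv awalk_Cons_iff awalk_Nil_iff)
      then show ?thesis using bip.edge_cases uv by metis
    qed
  qed
  have "packing G ((1 # replicate k 3) ! (i - 1)) {v \<in> pverts G. c v = i}"
    if "i \<in> {1..length (1 # replicate k (3::nat))}" for i
  proof (cases "i = 1")
    case True
    have "u \<in> A" if "u \<in> pverts G" "c u = 1" for u
      using that AB c_B[of u] by (auto simp: K_def)
    moreover have "ereal (real 1) < graph_dist G u v" if "u \<in> A" "v \<in> A" "u \<noteq> v" for u v
      unfolding graph_dist_def using that by (intro less_\<mu>_unit gt_1)
    ultimately show ?thesis using True by (auto simp: packing_def simp del: of_nat_1 of_nat_Suc)
  next
    case False
    have "u \<in> B \<and> f u = i" if "u \<in> pverts G" "c u = i" for u
      using that AB c_B[of u] False by (auto simp: c_def split: if_splits)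
    moreover have "(1 # replicate k 3) ! (i - 1) = (3 :: nat)"
      using False that by (auto simp: nth_Cons')
    moreover have "ereal (real 3) < graph_dist G u v" if "u \<in> B" "v \<in> B" "u \<noteq> v" "f u = f v" for u v
      unfolding graph_dist_def using that by (intro less_\<mu>_unit gt_3)
    ultimately show ?thesis unfolding packing_def by auto
  qed
  moreover have "c \<in> pverts G \<rightarrow> {1..length (1 # replicate k (3::nat))}"
    using AB c_B by (fastforce simp: c_def K_def)
  ultimately show ?thesis
    unfolding S_packing_colorable_def S_packing_coloring_def by blast
qed

end
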